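(* Let $a\in\mathbb{R}$, let $\mathfrak{S}=\{x\in\mathbb{C}: -1\le \operatorname{Im}(x)\le 0\}$, and let $F$ be a complex function analytic on an open set containing $\{a\,x(x+i): x\in\mathfrak{S}\}$ such that $F(a\,x(x+i))=o\!\left(e^{\pi|x|}/|x|\right)$ uniformly for $x\in\mathfrak{S}$ as $\operatorname{Re}(x)\to\pm\infty$. Then $$\int_{-\infty}^{\infty}\frac{F(a\,x(x+i))}{\cosh(\pi x)}\,dx=F(a/4).$$
   Context: The integral over the real line is understood as $\lim_{R\to\infty}\int_{-R}^{R}$. *)

theory Defs
  imports "HOL-Complex_Analysis.Complex_Analysis" "HOL-Library.Landau_Symbols"
begin

definition strip :: "complex set" where
  "strip = {x. -1 \<le> Im x \<and> Im x \<le> 0}"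

(* Restricting the filter to the strip makes estimates along it uniform in Im x;
   at_infinity on the reals covers both Re x -> +infinity and Re x -> -infinity. *)
definition strip_ends :: "complex filter" where
  "strip_ends = inf (filtercomap Re at_infinity) (principal strip)"

(* The integral over the real line is the limit of the integrals over {-R..R}; integrability
   on each such interval is required because a nonexistent integral has a default value. *)
definition has_line_integral :: "(real \<Rightarrow> complex) \<Rightarrow> complex \<Rightarrow> bool" where
  "has_line_integral f l \<longleftrightarrow>
     (\<forall>R. f integrable_on {-R..R}) \<and> ((\<lambda>R. integral {-R..R} f) \<longlongrightarrow> l) at_top"

end

theory Submission
  imports Defs
begin

text \<open>
  Put \<open>g x = F (a x (x + \<i>))\<close> and \<open>h x = g x / cosh (\<pi> x)\<close>. The map \<open>x \<mapsto> -\<i> - x\<close> is the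
  half-turn about \<open>-\<i>/2\<close>; it preserves \<open>x (x + \<i>)\<close>, hence \<open>g\<close>, and changes the sign of
  \<open>cosh (\<pi> x)\<close>, so \<open>h (-\<i> - x) = - h x\<close>. It also maps the rectangle with corners \<open>-R - \<i>\<close> and
  \<open>R\<close> to itself, exchanging opposite sides, and since both \<open>h\<close> and \<open>dx\<close> change sign, opposite
  sides contribute equally to a contour integral
  (\<open>contour_integral_linepath_half_turn\<close>).
  The only singularity of \<open>h\<close> in the rectangle is the simple pole at its centre \<open>-\<i>/2\<close>, and the
  residue theorem gives \<open>- 2 g (-\<i>/2)\<close> for the whole boundary
  (\<open>contour_integral_rectpath_divide_cosh\<close>). Half of this identity says that the integral
  over \<open>{-R..R}\<close> equals \<open>g (-\<i>/2) = F (a/4)\<close> plus the contribution of the right side, of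
  length 1. On that side the growth hypothesis makes \<open>g\<close> negligible
  compared with \<open>\<bar>cosh (\<pi> x)\<bar> \<ge> exp (\<pi> R) / 4\<close> (\<open>norm_cosh_ge\<close>), and so the contribution
  vanishes in the limit (\<open>right_side_tendsto_0\<close>).
\<close>

section \<open>The hyperbolic cosine near the strip\<close>

lemma cosh_half_turn: "cosh (of_real pi * (- \<i> - x)) = - cosh (of_real pi * x :: complex)"
proof -
  have "cosh (of_real pi * (- \<i> - x)) = cos (of_real pi - \<i> * (of_real pi * x))"
    by (simp add: cosh_conv_cos algebra_simps)
  also have "\<dots> = - cosh (of_real pi * x)"
    by (simp add: cos_diff cosh_conv_cos)
  finally show ?thesis .
qed

lemma
  shows cosh_at_center: "cosh (of_real pi * (- \<i> / 2)) = 0"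
    and sinh_at_center: "sinh (of_real pi * (- \<i> / 2)) = - \<i>"
proof -
  have *: "\<i> * (of_real pi * (- \<i> / 2)) = (of_real (pi / 2) :: complex)"
    by (simp add: algebra_simps)
  show "cosh (of_real pi * (- \<i> / 2)) = 0"
    by (simp only: cosh_conv_cos * cos_of_real cos_pi_half of_real_0)
  show "sinh (of_real pi * (- \<i> / 2)) = - \<i>"
    by (simp only: sinh_conv_sin * sin_of_real sin_pi_half of_real_1 mult_1_right)
qed

lemma holomorphic_cosh_pi: "(\<lambda>z. cosh (of_real pi * z)) holomorphic_on A"
  unfolding cosh_field_def by (intro holomorphic_intros) auto

lemma cosh_zero_near_strip:
  assumes "cosh (of_real pi * z) = (0::complex)" "- 3 / 2 < Im z" "Im z < 1 / 2"
  shows "z = - \<i> / 2"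
proof -
  obtain n :: int where n: "\<i> * (of_real pi * z) = of_real (n * pi) + of_real pi / 2"
    using assms(1) by (auto simp: cosh_conv_cos cos_eq_0)
  have "Re (\<i> * (of_real pi * z)) = n * pi + pi / 2" "Im (\<i> * (of_real pi * z)) = 0"
    unfolding n by simp_all
  then have "pi * (- Im z) = pi * (n + 1 / 2)" "Re z = 0"
    by (simp_all add: algebra_simps)
  then have "- Im z = n + 1 / 2" "Re z = 0"
    by (simp_all only: mult_left_cancel[OF pi_neq_zero])
  moreover from this have "n = 0"
    using assms by linarith
  ultimately show ?thesis
    by (simp add: complex_eq_iff)
qed

lemma norm_cosh_ge:
  assumes "Re z \<ge> 1"
  shows "exp (Re z) / 4 \<le> norm (cosh z)"
proof -
  have "exp (Re z) - exp (- Re z) \<le> norm (exp z + exp (- z))"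
    using norm_triangle_ineq2[of "exp z" "- exp (- z)"] by simp
  also have "\<dots> = 2 * norm (cosh z)"
    by (simp add: cosh_field_def norm_divide)
  finally have "exp (Re z) - exp (- Re z) \<le> 2 * norm (cosh z)" .
  moreover have "exp (- Re z) \<le> 1"
    using assms by simp
  moreover have "exp (Re z) \<ge> 2"
    using exp_ge_add_one_self[of "Re z"] assms by linarith
  ultimately show ?thesis
    by linarith
qed

section \<open>The contour integral\<close>

text \<open>Under the substitution \<open>w \<mapsto> s - w\<close> both \<open>f w\<close> and \<open>dw\<close> change sign.\<close>

lemma contour_integral_linepath_half_turn:
  assumes "\<And>w. f (s - w) = - f w"
  shows "contour_integral (linepath (s - a) (s - b)) f = contour_integral (linepath a b) f"
proof -
  have "linepath (s - a) (s - b) x = s - linepath a b x" for x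
    by (simp add: linepath_def algebra_simps scaleR_conv_of_real)
  then have "f (linepath (s - a) (s - b) x) * (s - b - (s - a)) = f (linepath a b x) * (b - a)" for x
    by (simp only: assms) (simp add: algebra_simps)
  then show ?thesis
    by (simp only: contour_integral_integral vector_derivative_linepath_at)
qed

text \<open>
  The residue at the simple pole \<open>-\<i>/2\<close> is \<open>g (-\<i>/2) / (\<pi> sinh (-\<pi> \<i>/2)) = g (-\<i>/2) / (- \<pi> \<i>)\<close>.
  Since \<open>g (-\<i>/2)\<close> may vanish, it is computed as the limit of \<open>g w (w + \<i>/2) / cosh (\<pi> w)\<close>.
\<close>

lemma contour_integral_rectpath_divide_cosh:
  assumes "open V" "strip \<subseteq> V" "g holomorphic_on V" "R > 0"
  shows "contour_integral (rectpath (Complex (- R) (- 1)) (Complex R 0))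
           (\<lambda>w. g w / cosh (of_real pi * w)) = - 2 * g (- \<i> / 2)"
proof -
  define c :: complex where "c = - \<i> / 2"
  define Q where "Q = cbox (Complex (- R) (- 1)) (Complex R 0)"
  define \<gamma> where "\<gamma> = rectpath (Complex (- R) (- 1)) (Complex R 0)"
  define h where "h = (\<lambda>w. g w / cosh (of_real pi * w))"
  have "Q \<subseteq> V"
    using assms(2) by (auto simp: Q_def strip_def in_cbox_complex_iff)
  moreover have "compact Q"
    by (simp add: Q_def)
  ultimately obtain d where d: "d > 0" "(\<Union>x\<in>Q. ball x d) \<subseteq> V"
    using compact_subset_open_imp_ball_epsilon_subset assms(1) by metis
  define e where "e = min d (1 / 2)"
  have e: "e > 0" "e \<le> d" "e \<le> 1 / 2"
    using d by (auto simp: e_def)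
  \<comment> \<open>A convex neighbourhood of the rectangle that meets neither the complement of \<open>V\<close> nor another
      zero of \<open>cosh (\<pi> w)\<close>; the closest ones, \<open>\<i>/2\<close> and \<open>-3\<i>/2\<close>, are at distance 1/2.\<close>
  define S where "S = (\<Union>x\<in>Q. \<Union>y\<in>ball 0 e. {x + y})"
  have S: "open S" "convex S"
    unfolding S_def Q_def by (intro open_sums convex_sums convex_box convex_ball disjI2 open_ball)+
  have "Q \<subseteq> S"
    using e by (force simp: S_def)
  have "S \<subseteq> V"
  proof
    fix z assume "z \<in> S"
    then obtain x y where "x \<in> Q" "norm y < e" "z = x + y"
      by (auto simp: S_def)
    then have "z \<in> (\<Union>x\<in>Q. ball x d)"
      using e by (auto simp: dist_norm intro!: bexI[of _ x])
    then show "z \<in> V"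
      using d by blast
  qed
  have only_zero: "w = c" if "w \<in> S" "cosh (of_real pi * w) = 0" for w
  proof -
    obtain x y where xy: "x \<in> Q" "norm y < e" "w = x + y"
      using \<open>w \<in> S\<close> by (auto simp: S_def)
    have "\<bar>Im y\<bar> < 1 / 2"
      using abs_Im_le_cmod[of y] xy e by linarith
    moreover have "- 1 \<le> Im x" "Im x \<le> 0"
      using xy by (auto simp: Q_def in_cbox_complex_iff)
    ultimately have "- 3 / 2 < Im w" "Im w < 1 / 2"
      using xy by auto
    then show ?thesis
      using cosh_zero_near_strip that(2) by (simp add: c_def)
  qed
  have c_box: "c \<in> box (Complex (- R) (- 1)) (Complex R 0)"
    using assms(4) by (simp add: c_def in_box_complex_iff)
  then have "c \<in> S"
    using \<open>Q \<subseteq> S\<close> box_subset_cbox unfolding Q_def by blast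
  have g_holo: "g holomorphic_on S"
    using assms(3) \<open>S \<subseteq> V\<close> holomorphic_on_subset by blast
  have h_holo: "h holomorphic_on S - {c}"
    unfolding h_def using only_zero
    by (intro holomorphic_on_divide holomorphic_cosh_pi holomorphic_on_subset[OF g_holo]) auto
  have residue: "residue h c = g c / (- \<i> * of_real pi)"
  proof (rule residue_simple'[OF S(1) \<open>c \<in> S\<close> h_holo])
    have "((\<lambda>w. cosh (of_real pi * w)) has_field_derivative sinh (of_real pi * c) * of_real pi) (at c)"
      by (auto intro!: derivative_eq_intros)
    then have "((\<lambda>w. cosh (of_real pi * w)) has_field_derivative - \<i> * of_real pi) (at c)"
      by (simp only: c_def sinh_at_center)
    then have "((\<lambda>w. cosh (of_real pi * w) / (w - c)) \<longlongrightarrow> - \<i> * of_real pi) (at c)"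
      using cosh_at_center by (simp add: has_field_derivative_iff c_def)
    moreover have "(g \<longlongrightarrow> g c) (at c)"
      using holomorphic_on_imp_continuous_on[OF g_holo] S(1) \<open>c \<in> S\<close>
      by (simp add: continuous_on_eq_continuous_at isCont_def)
    ultimately have "((\<lambda>w. g w / (cosh (of_real pi * w) / (w - c))) \<longlongrightarrow> g c / (- \<i> * of_real pi)) (at c)"
      by (intro tendsto_divide) auto
    then show "((\<lambda>w. h w * (w - c)) \<longlongrightarrow> g c / (- \<i> * of_real pi)) (at c)"
      by (simp add: h_def)
  qed
  have path: "path_image \<gamma> = Q - box (Complex (- R) (- 1)) (Complex R 0)"
    unfolding \<gamma>_def Q_def using assms(4) by (intro path_image_rectpath_cbox_minus_box) auto
  have "contour_integral \<gamma> h = 2 * pi * \<i> * (\<Sum>p\<in>{c}. winding_number \<gamma> p * residue h p)"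
  proof (rule Residue_theorem[of S])
    show "path_image \<gamma> \<subseteq> S - {c}"
      using path \<open>Q \<subseteq> S\<close> c_box by blast
    show "\<forall>z. z \<notin> S \<longrightarrow> winding_number \<gamma> z = 0"
      unfolding \<gamma>_def using \<open>Q \<subseteq> S\<close> assms(4)
      by (intro allI impI winding_number_rectpath_outside) (auto simp: Q_def)
  qed (use S h_holo in \<open>auto simp: \<gamma>_def convex_connected\<close>)
  also have "\<dots> = - 2 * g c"
    using winding_number_rectpath[OF c_box] by (simp add: residue \<gamma>_def field_simps)
  finally show ?thesis
    by (simp add: \<gamma>_def h_def c_def)
qed

text \<open>
  With the half-turn symmetry the boundary integral is twice the sum of the right and the top side,
  and the top side is traversed from \<open>R\<close> to \<open>-R\<close>.
\<close>

lemma integral_divide_cosh_eq: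
  assumes "open V" "strip \<subseteq> V" "g holomorphic_on V" "R > 0"
    and sym: "\<And>w. g (- \<i> - w) = g w"
  shows "integral {-R..R} (\<lambda>x. g (of_real x) / cosh (of_real pi * of_real x)) =
         g (- \<i> / 2) + contour_integral (linepath (Complex R (- 1)) (Complex R 0))
                         (\<lambda>w. g w / cosh (of_real pi * w))"
proof -
  define h where "h = (\<lambda>w. g w / cosh (of_real pi * w))"
  define p q r s where "p = Complex (- R) (- 1)" and "q = Complex R (- 1)"
    and "r = Complex R 0" and "s = Complex (- R) 0"
  have refl: "h (- \<i> - w) = - h w" for w
    using cosh_half_turn[of w] sym[of w] by (simp add: h_def)
  have "g holomorphic_on strip - {- \<i> / 2}"
    using assms(2,3) holomorphic_on_subset by blast
  then have "h holomorphic_on strip - {- \<i> / 2}"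
    unfolding h_def
    by (intro holomorphic_on_divide holomorphic_cosh_pi)
      (auto simp: strip_def dest!: cosh_zero_near_strip)
  then have cont: "continuous_on (strip - {- \<i> / 2}) h"
    by (rule holomorphic_on_imp_continuous_on)
  have "closed_segment x y \<subseteq> strip - {- \<i> / 2}" if "(x, y) \<in> {(p, q), (q, r), (r, s), (s, p)}" for x y
    using that assms(4)
    by (auto simp: p_def q_def r_def s_def strip_def closed_segment_same_Re closed_segment_same_Im
        closed_segment_eq_real_ivl)
  then have "h contour_integrable_on linepath x y" if "(x, y) \<in> {(p, q), (q, r), (r, s), (s, p)}" for x y
    using that by (intro contour_integrable_continuous_linepath continuous_on_subset[OF cont]) blast
  then have int: "h contour_integrable_on linepath p q" "h contour_integrable_on linepath q r"
      "h contour_integrable_on linepath r s" "h contour_integrable_on linepath s p"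
    by auto
  have "- 2 * g (- \<i> / 2) = contour_integral (rectpath p r) h"
    using contour_integral_rectpath_divide_cosh[OF assms(1-4)] by (simp add: h_def p_def r_def)
  also have "\<dots> = contour_integral (linepath p q) h + contour_integral (linepath q r) h
      + contour_integral (linepath r s) h + contour_integral (linepath s p) h"
    using int by (simp add: rectpath_def Let_def p_def q_def r_def s_def)
  also have "contour_integral (linepath p q) h = contour_integral (linepath r s) h"
  proof -
    have "p = - \<i> - r" "q = - \<i> - s"
      by (simp_all add: p_def q_def r_def s_def complex_eq_iff)
    then show ?thesis
      using contour_integral_linepath_half_turn[of h "- \<i>" r s] refl by simp
  qed
  also have "contour_integral (linepath s p) h = contour_integral (linepath q r) h"
  proof -
    have "s = - \<i> - q" "p = - \<i> - r"
      by (simp_all add: p_def q_def r_def s_def complex_eq_iff)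
    then show ?thesis
      using contour_integral_linepath_half_turn[of h "- \<i>" q r] refl by simp
  qed
  also have "contour_integral (linepath r s) h = - integral {-R..R} (\<lambda>x. h (of_real x))"
  proof -
    have "s \<in> \<real>" "r \<in> \<real>" "Re s = - R" "Re r = R"
      by (simp_all add: r_def s_def complex_is_Real_iff)
    then have "contour_integral (linepath s r) h = integral {-R..R} (\<lambda>x. h (of_real x))"
      using contour_integral_linepath_Reals_eq[of s r h] assms(4) by simp
    moreover have "contour_integral (linepath r s) h = - contour_integral (linepath s r) h"
      using contour_integral_reversepath[of "linepath s r" h] by simp
    ultimately show ?thesis
      by simp
  qed
  finally have "2 * integral {-R..R} (\<lambda>x. h (of_real x)) =
      2 * (g (- \<i> / 2) + contour_integral (linepath q r) h)"
    by (simp add: algebra_simps)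
  then show ?thesis
    unfolding mult_cancel_left by (simp add: h_def q_def r_def)
qed

text \<open>
  For \<open>Re w = R\<close> and \<open>w\<close> in the strip, \<open>\<bar>w\<bar> \<le> R + 1\<close>, so \<open>exp (\<pi> \<bar>w\<bar>)\<close> exceeds \<open>exp (\<pi> R)\<close>
  by the constant factor \<open>exp \<pi>\<close> at most.
\<close>

lemma right_side_tendsto_0:
  assumes "open V" "strip \<subseteq> V" "g holomorphic_on V"
    and small: "g \<in> o[strip_ends](\<lambda>x. of_real (exp (pi * cmod x) / cmod x))"
  shows "((\<lambda>R. contour_integral (linepath (Complex R (- 1)) (Complex R 0))
             (\<lambda>w. g w / cosh (of_real pi * w))) \<longlongrightarrow> 0) at_top"
proof (rule tendstoI)
  fix e :: real assume "e > 0"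
  define h where "h = (\<lambda>w. g w / cosh (of_real pi * w))"
  define d where "d = e / (8 * exp pi)"
  have "d > 0"
    using \<open>e > 0\<close> by (simp add: d_def)
  from landau_o.smallD[OF small this]
  have "eventually (\<lambda>x. x \<in> strip \<longrightarrow> cmod (g x) \<le> d * (exp (pi * cmod x) / cmod x))
          (filtercomap Re at_infinity)"
    by (simp add: strip_ends_def eventually_inf_principal norm_divide)
  then obtain P where P: "eventually P at_infinity"
      "\<And>x. P (Re x) \<Longrightarrow> x \<in> strip \<Longrightarrow> cmod (g x) \<le> d * (exp (pi * cmod x) / cmod x)"
    by (auto simp: eventually_filtercomap)
  from P(1) have "eventually P at_top"
    using at_top_le_at_infinity filter_leD by blast
  moreover have "eventually (\<lambda>R. R \<ge> (1::real)) at_top"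
    by (rule eventually_ge_at_top)
  ultimately show "eventually (\<lambda>R. dist (contour_integral (linepath (Complex R (- 1)) (Complex R 0))
      (\<lambda>w. g w / cosh (of_real pi * w))) 0 < e) at_top"
  proof eventually_elim
    case (elim R)
    have seg: "Re w = R" "w \<in> strip" if "w \<in> closed_segment (Complex R (- 1)) (Complex R 0)" for w
      using that by (auto simp: closed_segment_same_Re closed_segment_eq_real_ivl strip_def)
    have bound: "norm (h w) \<le> e / 2" if "Re w = R" "w \<in> strip" for w
    proof -
      have w: "R \<le> norm w" "norm w \<le> R + 1"
        using that elim complex_Re_le_cmod[of w] cmod_le[of w] by (auto simp: strip_def)
      have "exp (pi * cmod w) \<le> exp (pi * (R + 1))"
        using w by simp
      then have "exp (pi * cmod w) / cmod w \<le> exp (pi * (R + 1)) / 1"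
        using w elim by (intro frac_le) auto
      then have "norm (g w) \<le> d * exp (pi * (R + 1))"
        using P(2)[of w] that elim \<open>d > 0\<close> by (smt (verit) div_by_1 mult_left_mono)
      also have "\<dots> = e / 8 * exp (pi * R)"
        by (simp add: d_def exp_add algebra_simps)
      finally have g: "norm (g w) \<le> e / 8 * exp (pi * R)" .
      have "1 * 1 \<le> pi * R"
        using elim pi_gt3 by (intro mult_mono) auto
      then have "exp (pi * R) / 4 \<le> norm (cosh (of_real pi * w))"
        using norm_cosh_ge[of "of_real pi * w"] that by simp
      then have "norm (h w) \<le> (e / 8 * exp (pi * R)) / (exp (pi * R) / 4)"
        unfolding h_def norm_divide using g \<open>e > 0\<close> by (intro frac_le) auto
      then show ?thesis
        by simp
    qed
    have "continuous_on (closed_segment (Complex R (- 1)) (Complex R 0)) h"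
    proof (rule holomorphic_on_imp_continuous_on)
      have "g holomorphic_on closed_segment (Complex R (- 1)) (Complex R 0)"
        using assms(2,3) seg(2) holomorphic_on_subset by blast
      moreover have "cosh (of_real pi * w) \<noteq> 0"
        if "w \<in> closed_segment (Complex R (- 1)) (Complex R 0)" for w
        using cosh_zero_near_strip[of w] seg[OF that] elim by (auto simp: strip_def)
      ultimately show "h holomorphic_on closed_segment (Complex R (- 1)) (Complex R 0)"
        unfolding h_def by (intro holomorphic_on_divide holomorphic_cosh_pi)
    qed
    then have "norm (contour_integral (linepath (Complex R (- 1)) (Complex R 0)) h)
        \<le> e / 2 * norm (Complex R 0 - Complex R (- 1))"
      using \<open>e > 0\<close> bound seg
      by (intro contour_integral_bound_linepath contour_integrable_continuous_linepath) auto
    also have "Complex R 0 - Complex R (- 1) = \<i>"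
      by (simp add: complex_eq_iff)
    finally show ?case
      using \<open>e > 0\<close> by (simp add: h_def)
  qed
qed

section \<open>The integral over the real line\<close>

theorem mainTheorem1:
  fixes a :: real and F :: "complex \<Rightarrow> complex" and U :: "complex set"
  assumes "open U"
    and "(\<lambda>x. of_real a * x * (x + \<i>)) ` strip \<subseteq> U"
    and "F analytic_on U"
    and "(\<lambda>x. F (of_real a * x * (x + \<i>)))
           \<in> o[strip_ends](\<lambda>x. of_real (exp (pi * cmod x) / cmod x))"
  shows "has_line_integral
           (\<lambda>x. F (of_real a * of_real x * (of_real x + \<i>)) / of_real (cosh (pi * x)))
           (F (of_real (a / 4)))"
proof -
  define p where "p = (\<lambda>x. of_real a * x * (x + \<i>))"
  define g where "g = (\<lambda>x. F (p x))"
  define V where "V = p -` U"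
  define f where "f = (\<lambda>x. g (of_real x) / cosh (of_real pi * of_real x))"
  have "open V"
    unfolding V_def p_def by (intro open_vimage assms continuous_intros)
  have "strip \<subseteq> V"
    using assms(2) by (auto simp: V_def p_def)
  have "g holomorphic_on V"
  proof -
    have "p holomorphic_on V"
      unfolding p_def by (intro holomorphic_intros)
    moreover have "F holomorphic_on U"
      using assms(3) by (rule analytic_imp_holomorphic)
    ultimately have "F \<circ> p holomorphic_on V"
      by (rule holomorphic_on_compose_gen) (auto simp: V_def)
    then show ?thesis
      by (simp add: g_def o_def)
  qed
  note V = \<open>open V\<close> \<open>strip \<subseteq> V\<close> \<open>g holomorphic_on V\<close>
  have sym: "g (- \<i> - w) = g w" for w
  proof -
    have "p (- \<i> - w) = p w"
      by (simp add: p_def algebra_simps)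
    then show ?thesis
      by (simp add: g_def)
  qed
  have center: "g (- \<i> / 2) = F (of_real (a / 4))"
    by (simp add: g_def p_def field_simps)
  have small: "g \<in> o[strip_ends](\<lambda>x. of_real (exp (pi * cmod x) / cmod x))"
    using assms(4) by (simp add: g_def p_def)
  have f_eq: "(\<lambda>x. F (of_real a * of_real x * (of_real x + \<i>)) / of_real (cosh (pi * x))) = f"
  proof
    fix x
    have "of_real (cosh (pi * x)) = (cosh (of_real pi * of_real x) :: complex)"
      by (simp add: cosh_field_def exp_of_real[symmetric])
    then show "F (of_real a * of_real x * (of_real x + \<i>)) / of_real (cosh (pi * x)) = f x"
      by (simp add: f_def g_def p_def)
  qed
  have "f integrable_on {-R..R}" for R
  proof (rule integrable_continuous_real)
    have "continuous_on (of_real ` {-R..R}) g"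
      using V by (intro holomorphic_on_imp_continuous_on holomorphic_on_subset[OF V(3)])
        (auto simp: strip_def)
    then have "continuous_on {-R..R} (\<lambda>x. g (of_real x))"
      by (rule continuous_on_compose2) (auto intro!: continuous_intros)
    moreover have "cosh (of_real pi * of_real x) \<noteq> (0::complex)" for x
      using cosh_zero_near_strip[of "of_real x"] by (auto simp: complex_eq_iff)
    ultimately show "continuous_on {-R..R} f"
      unfolding f_def cosh_def by (intro continuous_intros) (auto simp: cosh_def)
  qed
  moreover have "((\<lambda>R. integral {-R..R} f) \<longlongrightarrow> F (of_real (a / 4))) at_top"
  proof -
    have "((\<lambda>R. g (- \<i> / 2) + contour_integral (linepath (Complex R (- 1)) (Complex R 0))
            (\<lambda>w. g w / cosh (of_real pi * w))) \<longlongrightarrow> g (- \<i> / 2) + 0) at_top"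
      by (intro tendsto_intros right_side_tendsto_0[OF V small])
    moreover have "eventually (\<lambda>R. g (- \<i> / 2)
            + contour_integral (linepath (Complex R (- 1)) (Complex R 0))
                (\<lambda>w. g w / cosh (of_real pi * w)) = integral {-R..R} f) at_top"
      using eventually_gt_at_top[of 0]
      by eventually_elim (simp only: f_def integral_divide_cosh_eq[OF V _ sym])
    ultimately show ?thesis
      unfolding center add_0_right by (rule Lim_transform_eventually)
  qed
  ultimately show ?thesis
    unfolding f_eq has_line_integral_def by blast
qed

end
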